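(* Let $\mathbf{x}$ be a Koenigs lattice in $\mathbb{P}^M$ ($M\geq 2$) satisfying $\mathbf{x}_{(12)}+\mathbf{x}=F_{(1)}\mathbf{x}_{(1)}+F_{(2)}\mathbf{x}_{(2)}$, and let $\mathbf{x}'$ be a Koenigs transform of $\mathbf{x}$. Let $L$ be the congruence of the transformation (the $\mathbb{Z}^2$-family of lines $L$ joining $\mathbf{x}$ and $\mathbf{x}'$) and let $\mathbf{y}_1=L\cap L_{(-1)}$, $\mathbf{y}_2=L\cap L_{(-2)}$ be its focal lattices. Then, on every line $L$ of the congruence, $\mathbf{x}'$ is the image of $\mathbf{x}$ in the unique projective involution of $L$ mapping $\mathbf{y}_1$ into $\mathbf{y}_{1(1)}$ and $\mathbf{y}_2$ into $\mathbf{y}_{2(2)}$.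
   Context: Notation: for a function (or family) $g$ on $\mathbb{Z}^2$, $g_{(\pm1)}(n_1,n_2)=g(n_1\pm1,n_2)$, $g_{(\pm2)}(n_1,n_2)=g(n_1,n_2\pm1)$, $g_{(12)}(n_1,n_2)=g(n_1+1,n_2+1)$; $\Delta_i g=g_{(i)}-g$. Lattices are maps $\mathbb{Z}^2\to\mathbb{P}^M=\mathbb{P}(\mathbb{R}^{M+1})$ given by homogeneous coordinates $\mathbf{x}:\mathbb{Z}^2\to\mathbb{R}^{M+1}\setminus\{0\}$. A Koenigs lattice (in canonical gauge) is a lattice satisfying $\mathbf{x}_{(12)}+\mathbf{x}=F_{(1)}\mathbf{x}_{(1)}+F_{(2)}\mathbf{x}_{(2)}$ for a function $F:\mathbb{Z}^2\to\mathbb{R}$. Koenigs transform: let $\theta:\mathbb{Z}^2\to\mathbb{R}$ be a solution of the Moutard equation $\theta_{(12)}+\theta=F(\theta_{(1)}+\theta_{(2)})$, and put $\phi=\theta_{(1)}+\theta_{(2)}$, $\phi'=1/\theta_{(1)}+1/\theta_{(2)}$. A Koenigs transform of $\mathbf{x}$ (via $\theta$) is a solution $\mathbf{x}'$ of $$\Delta_1(\mathbf{x}'/\phi')=(\theta\theta_{(2)})_{(1)}\Delta_1(\mathbf{x}/\phi),\qquad \Delta_2(\mathbf{x}'/\phi')=-(\theta\theta_{(1)})_{(2)}\Delta_2(\mathbf{x}/\phi).$$ The neighbouring lines $L$, $L_{(i)}$ then intersect; in particular the points $\mathbf{y}_1,\mathbf{y}_{1(1)},\mathbf{y}_2,\mathbf{y}_{2(2)}$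 all lie on $L$. Genericity convention: $F$, $\theta$, $\phi$ vanish nowhere; $\mathbf{x},\mathbf{x}_{(1)},\mathbf{x}_{(2)}$ are linearly independent at every point; the points $\mathbf{x}$ and $\mathbf{x}'$ of $\mathbb{P}^M$ are distinct and $L\neq L_{(-1)}$, $L\ne L_{(-2)}$ at every point of $\mathbb{Z}^2$, so that the focal points are well defined. A projective involution of a projective line is a projective transformation $h\neq \mathrm{id}$ with $h^2=\mathrm{id}$. *)

theory Defs
  imports "HOL-Analysis.Analysis" "HOL-Library.FuncSet"
begin

text \<open>
  Projective subspaces of \<open>P(V)\<close> are represented by the corresponding linear subspaces of \<open>V\<close>,
  so a point is a one-dimensional subspace, and the point with homogeneous coordinates \<open>v \<noteq> 0\<close>
  is \<open>span {v}\<close>.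
\<close>

definition proj_points :: "'a::real_vector set \<Rightarrow> 'a set set" where
  "proj_points W = {P. subspace P \<and> dim P = 1 \<and> P \<subseteq> W}"

text \<open>
  A linear automorphism of \<open>W\<close> extends to a linear map on the ambient space, so taking \<open>f\<close>
  globally linear loses nothing. The restriction makes equality of transformations the same as
  equality on the points of \<open>W\<close>, as needed for uniqueness statements.
\<close>

definition projective_transformation :: "'a::real_vector set \<Rightarrow> ('a set \<Rightarrow> 'a set) \<Rightarrow> bool" where
  "projective_transformation W h \<longleftrightarrow>
    (\<exists>f. linear f \<and> bij_betw f W W \<and> h = (\<lambda>P\<in>proj_points W. f ` P))"

definition projective_involution :: "'a::real_vector set \<Rightarrow> ('a set \<Rightarrow> 'a set) \<Rightarrow> bool" where
  "projective_involution W h \<longleftrightarrow>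
    projective_transformation W h \<and>
    (\<exists>P\<in>proj_points W. h P \<noteq> P) \<and> (\<forall>P\<in>proj_points W. h (h P) = P)"

definition \<Delta>\<^sub>1 :: "(int \<Rightarrow> int \<Rightarrow> 'a::real_vector) \<Rightarrow> int \<Rightarrow> int \<Rightarrow> 'a" where
  "\<Delta>\<^sub>1 g i j = g (i + 1) j - g i j"

definition \<Delta>\<^sub>2 :: "(int \<Rightarrow> int \<Rightarrow> 'a::real_vector) \<Rightarrow> int \<Rightarrow> int \<Rightarrow> 'a" where
  "\<Delta>\<^sub>2 g i j = g i (j + 1) - g i j"

definition lattice_coords :: "(int \<Rightarrow> int \<Rightarrow> 'a::real_vector) \<Rightarrow> bool" where
  "lattice_coords x \<longleftrightarrow> (\<forall>i j. x i j \<noteq> 0)"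

definition koenigs_lattice ::
  "(int \<Rightarrow> int \<Rightarrow> real) \<Rightarrow> (int \<Rightarrow> int \<Rightarrow> 'a::real_vector) \<Rightarrow> bool" where
  "koenigs_lattice F x \<longleftrightarrow>
    lattice_coords x \<and>
    (\<forall>i j. x (i + 1) (j + 1) + x i j =
      F (i + 1) j *\<^sub>R x (i + 1) j + F i (j + 1) *\<^sub>R x i (j + 1))"

definition moutard_solution ::
  "(int \<Rightarrow> int \<Rightarrow> real) \<Rightarrow> (int \<Rightarrow> int \<Rightarrow> real) \<Rightarrow> bool" where
  "moutard_solution F \<theta> \<longleftrightarrow>
    (\<forall>i j. \<theta> (i + 1) (j + 1) + \<theta> i j = F i j * (\<theta> (i + 1) j + \<theta> i (j + 1)))"

definition koenigs_phi :: "(int \<Rightarrow> int \<Rightarrow> real) \<Rightarrow> int \<Rightarrow> int \<Rightarrow> real" where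
  "koenigs_phi \<theta> i j = \<theta> (i + 1) j + \<theta> i (j + 1)"

definition koenigs_phi' :: "(int \<Rightarrow> int \<Rightarrow> real) \<Rightarrow> int \<Rightarrow> int \<Rightarrow> real" where
  "koenigs_phi' \<theta> i j = 1 / \<theta> (i + 1) j + 1 / \<theta> i (j + 1)"

definition koenigs_transform ::
  "(int \<Rightarrow> int \<Rightarrow> real) \<Rightarrow> (int \<Rightarrow> int \<Rightarrow> real) \<Rightarrow>
   (int \<Rightarrow> int \<Rightarrow> 'a::real_vector) \<Rightarrow> (int \<Rightarrow> int \<Rightarrow> 'a) \<Rightarrow> bool" where
  "koenigs_transform F \<theta> x x' \<longleftrightarrow>
    moutard_solution F \<theta> \<and> lattice_coords x' \<and>
    (let a = (\<lambda>i j. x i j /\<^sub>R koenigs_phi \<theta> i j);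
         a' = (\<lambda>i j. x' i j /\<^sub>R koenigs_phi' \<theta> i j)
     in \<forall>i j.
       \<Delta>\<^sub>1 a' i j = (\<theta> (i + 1) j * \<theta> (i + 1) (j + 1)) *\<^sub>R \<Delta>\<^sub>1 a i j \<and>
       \<Delta>\<^sub>2 a' i j = - (\<theta> i (j + 1) * \<theta> (i + 1) (j + 1)) *\<^sub>R \<Delta>\<^sub>2 a i j)"

definition congruence_line ::
  "(int \<Rightarrow> int \<Rightarrow> 'a::real_vector) \<Rightarrow> (int \<Rightarrow> int \<Rightarrow> 'a) \<Rightarrow> int \<Rightarrow> int \<Rightarrow> 'a set" where
  "congruence_line x x' i j = span {x i j, x' i j}"

definition focal1 ::
  "(int \<Rightarrow> int \<Rightarrow> 'a::real_vector) \<Rightarrow> (int \<Rightarrow> int \<Rightarrow> 'a) \<Rightarrow> int \<Rightarrow> int \<Rightarrow> 'a set" where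
  "focal1 x x' i j = congruence_line x x' i j \<inter> congruence_line x x' (i - 1) j"

definition focal2 ::
  "(int \<Rightarrow> int \<Rightarrow> 'a::real_vector) \<Rightarrow> (int \<Rightarrow> int \<Rightarrow> 'a) \<Rightarrow> int \<Rightarrow> int \<Rightarrow> 'a set" where
  "focal2 x x' i j = congruence_line x x' i j \<inter> congruence_line x x' i (j - 1)"

text \<open>
  The distinctness condition is needed because \<open>independent\<close> is a property of a set of vectors,
  not of a family.
\<close>

definition koenigs_generic ::
  "(int \<Rightarrow> int \<Rightarrow> real) \<Rightarrow> (int \<Rightarrow> int \<Rightarrow> real) \<Rightarrow>
   (int \<Rightarrow> int \<Rightarrow> 'a::real_vector) \<Rightarrow> (int \<Rightarrow> int \<Rightarrow> 'a) \<Rightarrow> bool" where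
  "koenigs_generic F \<theta> x x' \<longleftrightarrow>
    (\<forall>i j.
      F i j \<noteq> 0 \<and> \<theta> i j \<noteq> 0 \<and> koenigs_phi \<theta> i j \<noteq> 0 \<and>
      distinct [x i j, x (i + 1) j, x i (j + 1)] \<and>
      independent {x i j, x (i + 1) j, x i (j + 1)} \<and>
      span {x i j} \<noteq> span {x' i j} \<and>
      congruence_line x x' i j \<noteq> congruence_line x x' (i - 1) j \<and>
      congruence_line x x' i j \<noteq> congruence_line x x' i (j - 1))"

end

theory Submission
  imports Defs
begin

text \<open>
  Put \<open>a = x/\<phi>\<close> and \<open>a' = x'/\<phi>'\<close>, a basis of \<open>L\<close>. The transform equations say that \<open>a' - t a\<close> is
  unchanged by a shift in the first direction if \<open>t = \<theta>_(1) \<theta>_(12)\<close>, and in the second direction if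
  \<open>t = -\<theta>_(2) \<theta>_(12)\<close>. So, with \<open>t\<close> as affine parameter on \<open>L\<close>, the points \<open>y1\<close>, \<open>y1_(1)\<close> are
  \<open>\<theta> \<theta>_(2)\<close>, \<open>\<theta>_(1) \<theta>_(12)\<close>, and the points \<open>y2\<close>, \<open>y2_(2)\<close> are \<open>-\<theta> \<theta>_(1)\<close>, \<open>-\<theta>_(2) \<theta>_(12)\<close>.
  Both pairs have the product \<open>k = \<theta> \<theta>_(1) \<theta>_(2) \<theta>_(12)\<close>, so the involution \<open>t \<mapsto> k/t\<close> matches them
  and swaps \<open>x\<close> and \<open>x'\<close>. By the Moutard equation the sums of the two pairs differ by
  \<open>(\<theta> + \<theta>_(12)) (\<theta>_(1) + \<theta>_(2)) = F \<phi>\<^sup>2 \<noteq> 0\<close>, which makes the involution unique.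
\<close>

section \<open>Projective points and lines as spans\<close>

lemma span_singleton_eqI:
  fixes u v :: "'a::real_vector"
  assumes "u \<noteq> 0" "u \<in> span {v}"
  shows "span {u} = span {v}"
proof -
  obtain c where c: "u = c *\<^sub>R v"
    using assms(2) by (auto simp: span_singleton)
  with assms(1) have "v = (1 / c) *\<^sub>R u"
    by auto
  then have "v \<in> span {u}"
    by (metis span_base span_scale singletonI)
  with assms(2) show ?thesis
    by (simp add: span_eq)
qed

lemma span_singleton_scaleR:
  fixes v :: "'a::real_vector"
  assumes "c \<noteq> 0"
  shows "span {c *\<^sub>R v} = span {v}"
proof (cases "v = 0")
  case False
  then show ?thesis
    using assms by (intro span_singleton_eqI span_scale span_base) simp_all
qed simp

lemma proj_points_span_iff:
  "P \<in> proj_points (span S) \<longleftrightarrow> (\<exists>v\<in>span S. v \<noteq> 0 \<and> P = span {v})"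
proof
  assume P: "P \<in> proj_points (span S)"
  then have sub: "subspace P" and dim: "dim P = 1" and le: "P \<subseteq> span S"
    by (auto simp: proj_points_def)
  obtain B where B: "B \<subseteq> P" "independent B" "P \<subseteq> span B" "card B = dim P"
    by (rule basis_exists)
  with dim obtain v where "B = {v}"
    by (metis card_1_singletonE)
  with B sub le show "\<exists>v\<in>span S. v \<noteq> 0 \<and> P = span {v}"
    by (intro bexI[of _ v]) (use span_minimal[of B P] in auto)
next
  assume "\<exists>v\<in>span S. v \<noteq> 0 \<and> P = span {v}"
  then obtain v where v: "v \<in> span S" "v \<noteq> 0" "P = span {v}"
    by blast
  moreover have "dim {v} = 1"
    using v(2) by (subst dim_eq_card_independent) auto
  ultimately show "P \<in> proj_points (span S)"
    by (simp add: proj_points_def span_minimal)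
qed

lemma lin_indep_pairD:
  fixes a b :: "'a::real_vector"
  assumes "b \<noteq> 0" "a \<notin> span {b}" "p *\<^sub>R a + q *\<^sub>R b = 0"
  shows "p = 0 \<and> q = 0"
proof -
  have "p = 0"
  proof (rule ccontr)
    assume "p \<noteq> 0"
    have "p *\<^sub>R a = - q *\<^sub>R b"
      using assms(3) by (simp add: eq_neg_iff_add_eq_0)
    then have "inverse p *\<^sub>R (p *\<^sub>R a) = (- (q / p)) *\<^sub>R b"
      by (simp add: divide_inverse mult.commute)
    then have "a = (- (q / p)) *\<^sub>R b"
      using \<open>p \<noteq> 0\<close> by simp
    with assms(2) show False
      by (metis span_base span_scale singletonI)
  qed
  with assms show ?thesis
    by auto
qed

text \<open>A vector of \<open>span {a, b}\<close> outside \<open>span {u, v}\<close> would give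
  three independent vectors in a space spanned by at most two, against the Steinitz bound.\<close>

lemma span_pair_eqI:
  fixes a b u v :: "'a::real_vector"
  assumes "v \<noteq> 0" "u \<notin> span {v}" "u \<in> span {a, b}" "v \<in> span {a, b}"
  shows "span {u, v} = span {a, b}"
proof -
  have "u \<noteq> v"
    using assms(2) by (auto simp: span_base)
  have ind: "independent {u, v}"
    using assms by (simp add: independent_insert)
  have "w \<in> span {u, v}" if w: "w \<in> span {a, b}" for w
  proof (rule ccontr)
    assume nw: "w \<notin> span {u, v}"
    then have "independent {w, u, v}"
      using ind assms(1) by (auto simp: independent_insert split: if_splits)
    then have "card {w, u, v} \<le> card {a, b}"
      using independent_span_bound[of "{a, b}" "{w, u, v}"] w assms(3,4) by simp
    moreover have "w \<noteq> u" "w \<noteq> v"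
      using nw by (auto simp: span_base)
    ultimately show False
      using \<open>u \<noteq> v\<close> by (simp add: card_insert_if split: if_splits)
  qed
  with assms(3,4) show ?thesis
    by (auto simp: span_eq span_base)
qed

text \<open>By \<open>span_pair_eqI\<close>, a common vector outside \<open>span {v}\<close> would
  make both spans equal to its span with \<open>v\<close>. So a focal point is found by exhibiting
  one nonzero vector on both lines.\<close>

lemma span_pair_Int_eq_span_singleton:
  fixes a b c d v :: "'a::real_vector"
  assumes "span {a, b} \<noteq> span {c, d}" "v \<noteq> 0" "v \<in> span {a, b}" "v \<in> span {c, d}"
  shows "span {a, b} \<inter> span {c, d} = span {v}"
proof
  show "span {a, b} \<inter> span {c, d} \<subseteq> span {v}"
    using assms span_pair_eqI[of v] by blast
  show "span {v} \<subseteq> span {a, b} \<inter> span {c, d}"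
    using assms by (simp add: span_minimal)
qed

section \<open>Involutions of a line matching two pairs of points\<close>

text \<open>\<open>P r\<close> is the point with affine parameter \<open>r\<close>;
  \<open>span {b}\<close> has parameter 0 and \<open>span {a}\<close> is at infinity. An involution
  has a matrix of trace zero, and each prescribed pair is one linear condition on its entries. Two
  pairs with the same product \<open>k\<close> but different sums leave only the multiples of one
  matrix, that of \<open>r \<mapsto> k/r\<close>, which exchanges 0 and infinity.\<close>

lemma involution_matching_two_pairs:
  fixes a b :: "'a::real_vector"
  assumes ab: "b \<noteq> 0" "a \<notin> span {b}"
    and k: "k \<noteq> 0" "s * s' = k" "t * t' = k" "s + s' \<noteq> t + t'"
  defines "W \<equiv> span {a, b}"
  defines "P \<equiv> (\<lambda>r. span {b - r *\<^sub>R a})"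
  shows "(\<exists>!h. projective_involution W h \<and> h (P s) = P s' \<and> h (P t) = P t') \<and>
    (\<forall>h. projective_involution W h \<and> h (P s) = P s' \<and> h (P t) = P t' \<longrightarrow>
      h (span {a}) = span {b})"
proof -
  note ind = lin_indep_pairD[OF ab]
  have indD: "p = p' \<and> q = q'" if "p *\<^sub>R a + q *\<^sub>R b = p' *\<^sub>R a + q' *\<^sub>R b" for p q p' q'
    using ind[of "p - p'" "q - q'"] that by (simp add: algebra_simps)
  have ab_ne: "a \<noteq> b" "a \<noteq> 0"
    using ab by (auto simp: span_base span_zero)
  have memW: "v \<in> W \<longleftrightarrow> (\<exists>p q. v = p *\<^sub>R a + q *\<^sub>R b)" for v
    unfolding W_def by (auto simp: span_insert span_singleton algebra_simps)
  have P_ne: "b - r *\<^sub>R a \<noteq> 0" for r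
    using ind[of "- r" 1] by (auto simp: algebra_simps)
  have pts: "Q \<in> proj_points W \<longleftrightarrow> (\<exists>v\<in>W. v \<noteq> 0 \<and> Q = span {v})" for Q
    unfolding W_def by (rule proj_points_span_iff)
  have a_pt: "span {a} \<in> proj_points W"
    unfolding W_def proj_points_span_iff using ab_ne by (auto intro!: bexI[of _ a] span_base)
  have inda: "independent {a, b}"
    using ab by (simp add: independent_insert)
  \<comment> \<open>For \<open>r \<noteq> 0\<close>, \<open>b - r a\<close> goes to
    \<open>k a - r b = -r (b - (k/r) a)\<close>, so this \<open>g\<close> induces
    \<open>r \<mapsto> k/r\<close>.\<close>
  obtain g :: "'a \<Rightarrow> 'a" where g: "linear g" "g a = b" "g b = k *\<^sub>R a"
    using linear_independent_extend[OF inda, of "\<lambda>v. if v = a then b else k *\<^sub>R a"] ab_ne by auto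
  have gv: "g (p *\<^sub>R a + q *\<^sub>R b) = (k * q) *\<^sub>R a + p *\<^sub>R b" for p q
    by (simp add: linear_add[OF g(1)] linear_scale[OF g(1)] g(2,3) mult.commute add.commute)
  have gg: "g (g v) = k *\<^sub>R v" if "v \<in> W" for v
    using that by (auto simp: memW gv scaleR_add_right)
  have gW: "g v \<in> W" if "v \<in> W" for v
    using that by (fastforce simp: memW gv)
  have g_span: "g ` span {v} = span {g v}" for v
    using linear_span_image[OF g(1), of "{v}"] by simp
  have gne: "g v \<noteq> 0" if "v \<in> W" "v \<noteq> 0" for v
    using gg[OF that(1)] that k(1) linear_0[OF g(1)] by auto
  \<comment> \<open>On \<open>W\<close> the square of \<open>g\<close> is multiplication by
    \<open>k\<close>, so \<open>g/k\<close> is its inverse there.\<close>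
  have bij: "bij_betw g W W"
  proof (rule bij_betw_byWitness[where f' = "\<lambda>v. (1 / k) *\<^sub>R g v"])
    have sub: "subspace W"
      by (simp add: W_def)
    show "\<forall>v\<in>W. (1 / k) *\<^sub>R g (g v) = v" "\<forall>v\<in>W. g ((1 / k) *\<^sub>R g v) = v"
      using gg k(1) by (auto simp: linear_scale[OF g(1)])
    show "g ` W \<subseteq> W" "(\<lambda>v. (1 / k) *\<^sub>R g v) ` W \<subseteq> W"
      using gW sub by (auto intro: subspace_scale)
  qed
  define h0 where "h0 = (\<lambda>Q\<in>proj_points W. g ` Q)"
  have h0: "h0 (span {v}) = span {g v}" if "v \<in> W" "v \<noteq> 0" for v
    using that by (auto simp: h0_def g_span pts)
  have h0P: "h0 (P r) = P r'" if "r * r' = k" for r r'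
  proof -
    have "g (b - r *\<^sub>R a) = (- r) *\<^sub>R (b - r' *\<^sub>R a)"
      using gv[of "- r" 1] that by (simp add: algebra_simps)
    moreover have "- r \<noteq> 0"
      using that k(1) by auto
    moreover have mem: "b - r *\<^sub>R a \<in> W"
      unfolding W_def by (intro span_diff span_scale span_base) simp_all
    ultimately show ?thesis
      unfolding P_def using h0[OF mem P_ne] by (metis span_singleton_scaleR)
  qed
  have h0a: "h0 (span {a}) = span {b}"
    using h0[of a] g(2) ab_ne by (simp add: W_def span_base)
  have "projective_involution W h0"
    unfolding projective_involution_def projective_transformation_def
  proof (intro conjI ballI)
    show "\<exists>f. linear f \<and> bij_betw f W W \<and> h0 = (\<lambda>P\<in>proj_points W. f ` P)"
      using g(1) bij h0_def by blast
    have "span {b} \<noteq> span {a}"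
      using ab(2) by (auto simp: span_base)
    then show "\<exists>P\<in>proj_points W. h0 P \<noteq> P"
      using a_pt h0a by metis
    fix Q assume "Q \<in> proj_points W"
    then obtain v where v: "v \<in> W" "v \<noteq> 0" "Q = span {v}"
      unfolding pts by blast
    then have "h0 (h0 Q) = span {k *\<^sub>R v}"
      using h0 gW gne gg by simp
    with v k(1) show "h0 (h0 Q) = Q"
      by (simp add: span_singleton_scaleR)
  qed
  then have inv: "projective_involution W h0 \<and> h0 (P s) = P s' \<and> h0 (P t) = P t'"
    using h0P[OF k(2)] h0P[OF k(3)] by simp
  have unique: "h = h0"
    if matching: "projective_involution W h \<and> h (P s) = P s' \<and> h (P t) = P t'" for h
  proof -
    from matching have h: "projective_involution W h"
      and hs: "h (P s) = P s'" and ht: "h (P t) = P t'"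
      by auto
    obtain f where f: "linear f" "bij_betw f W W" and h_def: "h = (\<lambda>Q\<in>proj_points W. f ` Q)"
      using h unfolding projective_involution_def projective_transformation_def by blast
    have f_span: "f ` span {v} = span {f v}" for v
      using linear_span_image[OF f(1), of "{v}"] by simp
    have fW: "f v \<in> W" if "v \<in> W" for v
      using f(2) that by (auto simp: bij_betw_def)
    have f0: "f v \<noteq> 0" if "v \<in> W" "v \<noteq> 0" for v
    proof -
      have "0 \<in> W"
        by (simp add: W_def span_zero)
      with that f(2) have "f v \<noteq> f 0"
        by (auto simp: bij_betw_def dest: inj_onD)
      then show ?thesis
        using linear_0[OF f(1)] by simp
    qed
    have hv: "h (span {v}) = span {f v}" if "v \<in> W" "v \<noteq> 0" for v
      using that by (auto simp: h_def f_span pts)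
    have hhv: "f (f v) \<in> span {v}" if "v \<in> W" "v \<noteq> 0" for v
    proof -
      have "span {f (f v)} = h (h (span {v}))"
        using that fW f0 by (simp add: hv)
      also have "\<dots> = span {v}"
        using h that pts unfolding projective_involution_def by blast
      finally show ?thesis
        by (metis span_base singletonI)
    qed
    have aW: "a \<in> W" and bW: "b \<in> W"
      by (simp_all add: W_def span_base)
    obtain \<alpha> \<gamma> where fa: "f a = \<alpha> *\<^sub>R a + \<gamma> *\<^sub>R b"
      using fW[OF aW] memW by blast
    obtain \<beta> \<delta> where fb: "f b = \<beta> *\<^sub>R a + \<delta> *\<^sub>R b"
      using fW[OF bW] memW by blast
    have fv: "f (p *\<^sub>R a + q *\<^sub>R b) = (p * \<alpha> + q * \<beta>) *\<^sub>R a + (p * \<gamma> + q * \<delta>) *\<^sub>R b" for p q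
      by (simp add: linear_add[OF f(1)] linear_scale[OF f(1)] fa fb algebra_simps)
    \<comment> \<open>The square of the matrix of \<open>f\<close> is scalar, and its off-diagonal
      entries are \<open>\<gamma> (\<alpha> + \<delta>)\<close> and
      \<open>\<beta> (\<alpha> + \<delta>)\<close>. With nonzero trace the matrix would be diagonal,
      then scalar, and \<open>h\<close> would be the identity.\<close>
    have trace: "\<delta> = - \<alpha>"
    proof (rule ccontr)
      assume "\<delta> \<noteq> - \<alpha>"
      then have nz: "\<alpha> + \<delta> \<noteq> 0"
        by auto
      obtain c where "f (f a) = c *\<^sub>R a"
        using hhv[OF aW] ab_ne by (auto simp: span_singleton)
      then have "\<gamma> * (\<alpha> + \<delta>) = 0"
        using indD[of "\<alpha> * \<alpha> + \<gamma> * \<beta>" "\<alpha> * \<gamma> + \<gamma> * \<delta>" c 0] by (simp add: fa fv algebra_simps)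
      with nz have \<gamma>: "\<gamma> = 0"
        by simp
      obtain c where "f (f b) = c *\<^sub>R b"
        using hhv[OF bW] ab by (auto simp: span_singleton)
      then have "\<beta> * (\<alpha> + \<delta>) = 0"
        using indD[of "\<beta> * \<alpha> + \<delta> * \<beta>" "\<beta> * \<gamma> + \<delta> * \<delta>" 0 c] by (simp add: fb fv algebra_simps)
      with nz have \<beta>: "\<beta> = 0"
        by simp
      \<comment> \<open>The points of \<open>a\<close> and \<open>b\<close> alone allow two
        different eigenvalues of the square; the third point \<open>a + b\<close> forces them to be
        equal.\<close>
      have "a + b \<noteq> 0"
        using ind[of 1 1] by auto
      then obtain c where "f (f (a + b)) = c *\<^sub>R (a + b)"
        using hhv[of "a + b"] aW bW by (auto simp: span_singleton W_def span_add)
      then have "\<alpha> * \<alpha> = c" "\<delta> * \<delta> = c"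
        using indD[of "\<alpha> * \<alpha>" "\<delta> * \<delta>" c c] fv[of 1 1] fv[of \<alpha> \<delta>] \<beta> \<gamma> by (simp_all add: algebra_simps)
      then have "(\<alpha> - \<delta>) * (\<alpha> + \<delta>) = 0"
        by (simp add: algebra_simps)
      with nz have "\<alpha> = \<delta>"
        by simp
      then have fsc: "f v = \<alpha> *\<^sub>R v" if "v \<in> W" for v
        using that by (auto simp: memW fv \<beta> \<gamma> algebra_simps)
      have "h Q = Q" if Q: "Q \<in> proj_points W" for Q
      proof -
        obtain v where v: "v \<in> W" "v \<noteq> 0" "Q = span {v}"
          using Q unfolding pts by blast
        then have "\<alpha> \<noteq> 0"
          using f0[of v] fsc[of v] by auto
        with v show ?thesis
          using hv[of v] fsc[of v] by (simp add: span_singleton_scaleR)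
      qed
      with h show False
        unfolding projective_involution_def by blast
    qed
    \<comment> \<open>The coefficient of \<open>b\<close> determines the factor between
      \<open>f (b - r a)\<close> and \<open>b - r' a\<close>; substituting it into the coefficient
      of \<open>a\<close> gives the relation, symmetric in \<open>r\<close> and \<open>r'\<close>
      because of the zero trace.\<close>
    have pair: "\<beta> = \<alpha> * (r + r') + \<gamma> * (r * r')" if "h (P r) = P r'" for r r'
    proof -
      have mem: "b - r *\<^sub>R a \<in> W"
        unfolding W_def by (intro span_diff span_scale span_base) simp_all
      then have "span {f (b - r *\<^sub>R a)} = span {b - r' *\<^sub>R a}"
        using that hv[OF mem P_ne] by (simp add: P_def)
      then have "f (b - r *\<^sub>R a) \<in> span {b - r' *\<^sub>R a}"
        using span_base[of "f (b - r *\<^sub>R a)" "{f (b - r *\<^sub>R a)}"] by simp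
      then obtain c where "f (b - r *\<^sub>R a) = c *\<^sub>R (b - r' *\<^sub>R a)"
        by (auto simp: span_singleton)
      moreover have "f (b - r *\<^sub>R a) = (\<beta> - r * \<alpha>) *\<^sub>R a + (- r * \<gamma> - \<alpha>) *\<^sub>R b"
        using fv[of "- r" 1] trace by simp
      moreover have "c *\<^sub>R (b - r' *\<^sub>R a) = (- c * r') *\<^sub>R a + c *\<^sub>R b"
        by (simp add: algebra_simps)
      ultimately have "\<beta> - r * \<alpha> = - c * r' \<and> - r * \<gamma> - \<alpha> = c"
        by (intro indD) simp
      then have c: "c = - r * \<gamma> - \<alpha>" and "\<beta> = r * \<alpha> - c * r'"
        by auto
      then show ?thesis
        unfolding c by (simp add: algebra_simps)
    qed
    \<comment> \<open>Since both products are \<open>k\<close>, subtracting the two relations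
      cancels \<open>\<beta>\<close> and \<open>\<gamma> k\<close>.\<close>
    have "\<alpha> * (s + s') = \<alpha> * (t + t')"
      using pair[OF hs] pair[OF ht] k by simp
    with k(4) have \<alpha>: "\<alpha> = 0"
      by simp
    then have \<beta>: "\<beta> = \<gamma> * k"
      using pair[OF hs] k by simp
    have f_eq: "f v = \<gamma> *\<^sub>R g v" if "v \<in> W" for v
      using that trace by (auto simp: memW fv gv \<alpha> \<beta> algebra_simps)
    \<comment> \<open>On points of \<open>W\<close> the factor \<open>\<gamma>\<close> does not
      matter; elsewhere both maps are \<open>undefined\<close> by restriction. Hence they are equal
      as functions.\<close>
    have "h Q = h0 Q" for Q
    proof (cases "Q \<in> proj_points W")
      case True
      then obtain v where v: "v \<in> W" "v \<noteq> 0" "Q = span {v}"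
        unfolding pts by blast
      then have "\<gamma> \<noteq> 0"
        using f0[of v] f_eq[of v] by auto
      with v show ?thesis
        using hv[of v] h0[of v] f_eq[of v] by (simp add: span_singleton_scaleR)
    next
      case False
      then show ?thesis
        by (simp add: h_def h0_def)
    qed
    then show ?thesis ..
  qed
  show ?thesis
  proof (intro conjI allI impI)
    show "\<exists>!h. projective_involution W h \<and> h (P s) = P s' \<and> h (P t) = P t'"
      by (rule ex1I[where a = h0], rule inv, rule unique)
    show "h (span {a}) = span {b}"
      if "projective_involution W h \<and> h (P s) = P s' \<and> h (P t) = P t'" for h
      using unique[OF that] h0a by simp
  qed
qed

section \<open>Normalised coordinates and focal points of the congruence\<close>

lemma span_pair_scale:
  fixes u v :: "'a::real_vector"
  assumes "p \<noteq> 0" "q \<noteq> 0"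
  shows "span {p *\<^sub>R u, q *\<^sub>R v} = span {u, v}"
proof -
  have "inverse p *\<^sub>R (p *\<^sub>R u) \<in> span {p *\<^sub>R u, q *\<^sub>R v}" "inverse q *\<^sub>R (q *\<^sub>R v) \<in> span {p *\<^sub>R u, q *\<^sub>R v}"
    by (intro span_scale span_base; simp)+
  with assms have "u \<in> span {p *\<^sub>R u, q *\<^sub>R v}" "v \<in> span {p *\<^sub>R u, q *\<^sub>R v}"
    by simp_all
  then show ?thesis
    by (auto simp: span_eq span_base span_scale)
qed

theorem proposition4p3:
  fixes M :: nat
    and F \<theta> :: "int \<Rightarrow> int \<Rightarrow> real"
    and x x' :: "int \<Rightarrow> int \<Rightarrow> real ^ 'n"
  assumes "M \<ge> 2"
    and "CARD('n) = M + 1"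
    and "koenigs_lattice F x"
    and "koenigs_transform F \<theta> x x'"
    and "koenigs_generic F \<theta> x x'"
  shows "\<forall>i j.
    let L = congruence_line x x' i j;
        y1 = focal1 x x' i j;
        y1_1 = focal1 x x' (i + 1) j;
        y2 = focal2 x x' i j;
        y2_2 = focal2 x x' i (j + 1)
    in {y1, y1_1, y2, y2_2} \<subseteq> proj_points L \<and>
       (\<exists>!h. projective_involution L h \<and> h y1 = y1_1 \<and> h y2 = y2_2) \<and>
       (\<forall>h. projective_involution L h \<and> h y1 = y1_1 \<and> h y2 = y2_2 \<longrightarrow>
            h (span {x i j}) = span {x' i j})"
proof -
  define a where "a = (\<lambda>i j. x i j /\<^sub>R koenigs_phi \<theta> i j)"
  define a' where "a' = (\<lambda>i j. x' i j /\<^sub>R koenigs_phi' \<theta> i j)"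
  have x0: "x i j \<noteq> 0" "x' i j \<noteq> 0" for i j
    using assms(3,4) by (auto simp: koenigs_lattice_def koenigs_transform_def lattice_coords_def)
  have \<theta>0: "\<theta> i j \<noteq> 0" and F0: "F i j \<noteq> 0" and \<phi>0: "koenigs_phi \<theta> i j \<noteq> 0" for i j
    using assms(5) by (auto simp: koenigs_generic_def)
  \<comment> \<open>This follows from
    \<open>\<phi>' = \<phi> / (\<theta>_(1) \<theta>_(2))\<close>.\<close>
  have \<phi>'0: "koenigs_phi' \<theta> i j \<noteq> 0" for i j
    using \<phi>0[of i j] \<theta>0[of "i + 1" j] \<theta>0[of i "j + 1"]
    by (simp add: koenigs_phi_def koenigs_phi'_def field_simps)
  have moutard: "\<theta> (i + 1) (j + 1) + \<theta> i j = F i j * koenigs_phi \<theta> i j" for i j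
    using assms(4) by (simp add: koenigs_transform_def moutard_solution_def koenigs_phi_def)
  have eq1: "a' (i + 1) j - a' i j = (\<theta> (i + 1) j * \<theta> (i + 1) (j + 1)) *\<^sub>R (a (i + 1) j - a i j)"
    and eq2: "a' i (j + 1) - a' i j = - (\<theta> i (j + 1) * \<theta> (i + 1) (j + 1)) *\<^sub>R (a i (j + 1) - a i j)"
    for i j
    using assms(4) unfolding koenigs_transform_def Let_def a_def a'_def \<Delta>\<^sub>1_def \<Delta>\<^sub>2_def by blast+
  have sa: "span {a i j} = span {x i j}" and sa': "span {a' i j} = span {x' i j}" for i j
    unfolding a_def a'_def using \<phi>0[of i j] \<phi>'0[of i j] x0[of i j]
    by (intro span_singleton_eqI span_scale span_base; simp)+
  have line: "congruence_line x x' i j = span {a i j, a' i j}" for i j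
    using \<phi>0[of i j] \<phi>'0[of i j] by (simp add: congruence_line_def a_def a'_def span_pair_scale)
  have a0: "a i j \<noteq> 0" "a' i j \<noteq> 0" for i j
    using \<phi>0[of i j] \<phi>'0[of i j] x0[of i j] by (auto simp: a_def a'_def)
  have indep: "a i j \<notin> span {a' i j}" for i j
  proof -
    have "span {a i j} \<noteq> span {a' i j}"
      using assms(5) unfolding sa sa' koenigs_generic_def by blast
    with a0 show ?thesis
      by (metis span_singleton_eqI)
  qed
  \<comment> \<open>This vector has coefficient 1 at \<open>a'\<close>, so it never vanishes; the
    shift equations identify such vectors themselves, not just the points they span.\<close>
  define P where "P = (\<lambda>i j r. a' i j - r *\<^sub>R a i j)"
  have P0: "P i j r \<noteq> 0" for i j r
    using lin_indep_pairD[OF a0(2)[of i j] indep[of i j], of "- r" 1] by (auto simp: P_def)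
  have P_line: "P i j r \<in> congruence_line x x' i j" for i j r
    unfolding P_def line by (intro span_diff span_scale span_base) simp_all
  have lines_ne: "congruence_line x x' i j \<noteq> congruence_line x x' (i - 1) j"
    "congruence_line x x' i j \<noteq> congruence_line x x' i (j - 1)" for i j
    using assms(5) unfolding koenigs_generic_def by blast+
  have shift1: "P (i + 1) j r = P i j r" if "r = \<theta> (i + 1) j * \<theta> (i + 1) (j + 1)" for i j r
    using eq1[of i j] unfolding that[symmetric] P_def by (simp add: algebra_simps)
  have shift2: "P i (j + 1) r = P i j r" if "r = - (\<theta> i (j + 1) * \<theta> (i + 1) (j + 1))" for i j r
    using eq2[of i j] unfolding that[symmetric] P_def by (simp add: algebra_simps)
  \<comment> \<open>The parameter is the one of \<open>shift1\<close> taken at \<open>i - 1\<close>,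
    so the same vector lies on the lines at \<open>i\<close> and at \<open>i - 1\<close>.\<close>
  have focal1: "focal1 x x' i j = span {P i j (\<theta> i j * \<theta> i (j + 1))}" for i j
  proof -
    let ?v = "P i j (\<theta> i j * \<theta> i (j + 1))"
    have "?v \<in> congruence_line x x' (i - 1) j"
      using P_line[of "i - 1" j] shift1[of _ "i - 1" j] by (metis diff_add_cancel)
    with P_line[of i j] lines_ne(1)[of i j] show ?thesis
      unfolding focal1_def line by (intro span_pair_Int_eq_span_singleton P0)
  qed
  have focal2: "focal2 x x' i j = span {P i j (- (\<theta> i j * \<theta> (i + 1) j))}" for i j
  proof -
    let ?v = "P i j (- (\<theta> i j * \<theta> (i + 1) j))"
    have "?v \<in> congruence_line x x' i (j - 1)"
      using P_line[of i "j - 1"] shift2[of _ i "j - 1"] by (metis diff_add_cancel)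
    with P_line[of i j] lines_ne(2)[of i j] show ?thesis
      unfolding focal2_def line by (intro span_pair_Int_eq_span_singleton P0)
  qed
  \<comment> \<open>The focal point at \<open>i + 1\<close> is rewritten in the basis of the line at
    \<open>i\<close>, so that all four focal points carry parameters on the same line.\<close>
  have focal1_shift: "focal1 x x' (i + 1) j = span {P i j (\<theta> (i + 1) j * \<theta> (i + 1) (j + 1))}" for i j
    using shift1[OF refl, of i j] by (simp add: focal1)
  have focal2_shift: "focal2 x x' i (j + 1) = span {P i j (- (\<theta> i (j + 1) * \<theta> (i + 1) (j + 1)))}" for i j
    using shift2[OF refl, of i j] by (simp add: focal2)
  \<comment> \<open>The difference of the two sides factors as
    \<open>(\<theta> + \<theta>_(12)) \<phi>\<close>; the Moutard equation and the nonvanishing of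
    \<open>F\<close> enter here.\<close>
  have sums_ne: "\<theta> i j * \<theta> i (j + 1) + \<theta> (i + 1) j * \<theta> (i + 1) (j + 1)
      \<noteq> - (\<theta> i j * \<theta> (i + 1) j) + - (\<theta> i (j + 1) * \<theta> (i + 1) (j + 1))" for i j
  proof -
    have "(\<theta> (i + 1) (j + 1) + \<theta> i j) * koenigs_phi \<theta> i j \<noteq> 0"
      using F0[of i j] \<phi>0[of i j] by (simp add: moutard)
    then show ?thesis
      unfolding koenigs_phi_def by (simp add: algebra_simps)
  qed
  have pts: "span {P i j r} \<in> proj_points (congruence_line x x' i j)" for i j r
    using P0 P_line[of i j r] unfolding line proj_points_span_iff by blast
  have involution: "(\<exists>!h. projective_involution (congruence_line x x' i j) h \<and>
        h (focal1 x x' i j) = focal1 x x' (i + 1) j \<and> h (focal2 x x' i j) = focal2 x x' i (j + 1)) \<and>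
      (\<forall>h. projective_involution (congruence_line x x' i j) h \<and>
        h (focal1 x x' i j) = focal1 x x' (i + 1) j \<and> h (focal2 x x' i j) = focal2 x x' i (j + 1) \<longrightarrow>
        h (span {x i j}) = span {x' i j})" for i j
    \<comment> \<open>The shifted focal points must be rewritten first, since \<open>focal1\<close>
      and \<open>focal2\<close> would express them in the bases of the neighbouring lines. The fact
      \<open>refl\<close> fixes \<open>k\<close> as the product of the first pair of
      parameters.\<close>
    unfolding focal1_shift focal2_shift unfolding focal1 focal2 line P_def
      sa[symmetric] sa'[symmetric]
    by (rule involution_matching_two_pairs[OF a0(2) indep _ refl _ sums_ne]) (simp_all add: \<theta>0)
  have focal_points: "{focal1 x x' i j, focal1 x x' (i + 1) j, focal2 x x' i j, focal2 x x' i (j + 1)}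
      \<subseteq> proj_points (congruence_line x x' i j)" for i j
    unfolding focal1_shift focal2_shift unfolding focal1 focal2 using pts by simp
  show ?thesis
    unfolding Let_def by (intro allI) (rule conjI[OF focal_points involution])
qed

end
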